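(* Let $0<d<1<u$ be real numbers, and let $n\ge1$, $t\ge 0$ be integers. (a) Let $q_u,q_d\ge 0$ be real numbers with $q_u+q_d\le 1$. For each integer $N\ge 1$ consider the bulls-and-bears model with parameters $N$, $N_u(0)=\lfloor q_uN\rfloor$, $N_d(0)=\lfloor q_dN\rfloor$, $u$, $d$. Then, as $N\to\infty$, $\mathbb{E}\left(\left(\log\frac{p(t)}{p(0)}\right)^n\right)$ converges to $$\sum_{\substack{n_u,n_d\in\mathbb{N}_0\\ n_u+n_d=n}}\frac{n!}{n_u!\,n_d!}(\log u)^{n_u}(\log d)^{n_d}\sum_{k_u=0}^{n_u}q_u^{k_u}\left\{\begin{matrix}n_u\\ k_u\end{matrix}\right\}\sum_{k_d=0}^{n_d}q_d^{k_d}\left\{\begin{matrix}n_d\\ k_d\end{matrix}\right\}\frac{t!}{(t-k_u-k_d)!}.$$ (b) Let $q_u\in[0,1]$ and let $(S(t))_{t\in\mathbb{N}_0}$ be the price process of the binomial model in which, at each step, independently of the past, the price is multiplied by $u$ with probability $q_u$ and by $d$ with probability $1-q_u$. Then $$\mathbb{E}\left(\left(\log\frac{S(t)}{S(0)}\right)^n\right)=\sum_{\substack{n_u,n_d\in\mathbb{N}_0\\ n_u+n_d=n}}\frac{n!}{n_u!\,n_d!}(\log u)^{n_u}(\log d)^{n_d}\sum_{k_u=0}^{n_u}q_u^{k_u}\left\{\begin{matrix}n_u\\ k_u\end{matrix}\right\}\sum_{k_d=0}^{n_d}(1-q_u)^{k_d}\left\{\begin{matrix}n_d\\ k_d\end{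matrix}\right\}\frac{t!}{(t-k_u-k_d)!}.$$
   Context: $\mathbb{N}_0$ denotes the nonnegative integers. The bulls-and-bears model with parameters $N,N_u(0),N_d(0),u,d$ (integers $N\ge1$, $N_u(0),N_d(0)\ge 0$, $N_u(0)+N_d(0)\le N$): there are $N$ investors. The process $(N_u(t),N_d(t),p(t))_{t\in\mathbb{N}_0}$ starts from the deterministic values $N_u(0),N_d(0),p(0)>0$. At each time $t$, conditionally on the whole history up to time $t$, exactly one of the following occurs: (bull chosen) with probability $N_u(t)/N$, $p(t+1)=u\,p(t)$, $N_u(t+1)=N_u(t)-1$, $N_d(t+1)=N_d(t)$; (bear chosen) with probability $N_d(t)/N$, $p(t+1)=d\,p(t)$, $N_d(t+1)=N_d(t)-1$, $N_u(t+1)=N_u(t)$; (inactive investor chosen) with probability $(N-N_u(t)-N_d(t))/N$, $p(t+1)=p(t)$, $N_u(t+1)=N_u(t)$, $N_d(t+1)=N_d(t)$. In the binomial model, $S(0)>0$ is deterministic. $\left\{\begin{matrix}n\\ k\end{matrix}\right\}$ is the Stirling number of the second kind: the number of partitions of a set of $n$ elements into $k$ nonempty sets (so $\left\{\begin{matrix}0\\ 0\end{matrix}\right\}=1$). $\frac{t!}{(t-k)!}$ denotes the falling factorial $t(t-1)\cdots(t-k+1)$, which is $0$ if $k>t$. Convention: $0^0=1$. *)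

theory Defs
  imports "HOL-Probability.Probability" "HOL-Combinatorics.Stirling"
begin

text \<open>The sub-\<sigma>-algebra of \<open>M\<close> generated by \<open>X 0, \<dots>, X t\<close>, where each \<open>X s\<close> is \<open>E\<close>-valued.\<close>

definition history :: "'w measure \<Rightarrow> 's measure \<Rightarrow> (nat \<Rightarrow> 'w \<Rightarrow> 's) \<Rightarrow> nat \<Rightarrow> 'w measure" where
  "history M E X t =
     vimage_algebra (space M) (\<lambda>\<omega>. \<lambda>s\<in>{..t}. X s \<omega>) (PiM {..t} (\<lambda>_. E))"

text \<open>
  Any realization of the model on a probability space. The three transition events are pairwise
  disjoint and their conditional probabilities sum to 1, so almost surely exactly one of them
  occurs at each time. A decrease of a counter is written as \<open>Nu t \<omega> = Nu (Suc t) \<omega> + 1\<close> to avoid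
  truncated subtraction.
\<close>

locale bulls_and_bears = prob_space M
  for M :: "'w measure" +
  fixes N nu0 nd0 :: nat and u d p0 :: real
    and Nu Nd :: "nat \<Rightarrow> 'w \<Rightarrow> nat" and p :: "nat \<Rightarrow> 'w \<Rightarrow> real"
  assumes N_pos: "1 \<le> N"
    and counts_le: "nu0 + nd0 \<le> N"
    and p0_pos: "0 < p0"
    and measurable_Nu: "\<And>t. random_variable (count_space UNIV) (Nu t)"
    and measurable_Nd: "\<And>t. random_variable (count_space UNIV) (Nd t)"
    and measurable_p: "\<And>t. random_variable borel (p t)"
    and initial: "AE \<omega> in M. Nu 0 \<omega> = nu0 \<and> Nd 0 \<omega> = nd0 \<and> p 0 \<omega> = p0"
    and bull_chosen: "\<And>t. AE \<omega> in M.
      real_cond_exp M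
        (history M (count_space UNIV \<Otimes>\<^sub>M count_space UNIV \<Otimes>\<^sub>M borel)
           (\<lambda>s \<omega>. (Nu s \<omega>, Nd s \<omega>, p s \<omega>)) t)
        (indicator {\<omega> \<in> space M. p (Suc t) \<omega> = u * p t \<omega> \<and>
                      Nu t \<omega> = Nu (Suc t) \<omega> + 1 \<and> Nd (Suc t) \<omega> = Nd t \<omega>}) \<omega>
      = real (Nu t \<omega>) / real N"
    and bear_chosen: "\<And>t. AE \<omega> in M.
      real_cond_exp M
        (history M (count_space UNIV \<Otimes>\<^sub>M count_space UNIV \<Otimes>\<^sub>M borel)
           (\<lambda>s \<omega>. (Nu s \<omega>, Nd s \<omega>, p s \<omega>)) t)
        (indicator {\<omega> \<in> space M. p (Suc t) \<omega> = d * p t \<omega> \<and>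
                      Nd t \<omega> = Nd (Suc t) \<omega> + 1 \<and> Nu (Suc t) \<omega> = Nu t \<omega>}) \<omega>
      = real (Nd t \<omega>) / real N"
    and inactive_chosen: "\<And>t. AE \<omega> in M.
      real_cond_exp M
        (history M (count_space UNIV \<Otimes>\<^sub>M count_space UNIV \<Otimes>\<^sub>M borel)
           (\<lambda>s \<omega>. (Nu s \<omega>, Nd s \<omega>, p s \<omega>)) t)
        (indicator {\<omega> \<in> space M. p (Suc t) \<omega> = p t \<omega> \<and>
                      Nu (Suc t) \<omega> = Nu t \<omega> \<and> Nd (Suc t) \<omega> = Nd t \<omega>}) \<omega>
      = (real N - real (Nu t \<omega>) - real (Nd t \<omega>)) / real N"

text \<open>
  Independence from the past: the growth factor of each step is independent of all prices so far.
  For \<open>u, d > 0\<close> prices are almost surely positive, so the quotient is the actual growth factor.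
\<close>

locale binomial_model = prob_space M
  for M :: "'w measure" +
  fixes q u d s0 :: real and S :: "nat \<Rightarrow> 'w \<Rightarrow> real"
  assumes s0_pos: "0 < s0"
    and measurable_S: "\<And>t. random_variable borel (S t)"
    and initial: "AE \<omega> in M. S 0 \<omega> = s0"
    and up_step: "\<And>t. prob {\<omega> \<in> space M. S (Suc t) \<omega> = u * S t \<omega>} = q"
    and down_step: "\<And>t. prob {\<omega> \<in> space M. S (Suc t) \<omega> = d * S t \<omega>} = 1 - q"
    and indep_past: "\<And>t. indep_set
      (sets (history M borel S t))
      (sets (vimage_algebra (space M) (\<lambda>\<omega>. S (Suc t) \<omega> / S t \<omega>) borel))"

text \<open>\<open>t (t - 1) \<dots> (t - k + 1)\<close>, which is \<open>0\<close> for \<open>k > t\<close>.\<close>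

definition falling_factorial :: "nat \<Rightarrow> nat \<Rightarrow> real" where
  "falling_factorial t k = (\<Prod>i<k. real t - real i)"

end

theory Submission
  imports Defs
begin

text \<open>
  In both models the pair (number of up moves, number of down moves) is a Markov chain on pairs of
  naturals started at \<open>(0, 0)\<close>, so expectations at time \<open>t\<close> are the \<open>t\<close>-th iterate of a one-step
  operator \<open>T\<close> evaluated at \<open>(0, 0)\<close>. In the bulls-and-bears model its coefficients are \<open>(Nu(0) - i) / N\<close>
  and \<open>(Nd(0) - j) / N\<close>, which tend to \<open>q_u\<close> and \<open>q_d\<close>; hence both parts reduce to the operator with
  constant coefficients. As \<open>T\<close> maps \<open>(i)\<^sub>k (j)\<^sub>l\<close> to
  \<open>(i)\<^sub>k (j)\<^sub>l + q_u k (i)\<^sub>k\<^sub>-\<^sub>1 (j)\<^sub>l + q_d l (i)\<^sub>k (j)\<^sub>l\<^sub>-\<^sub>1\<close>, its \<open>t\<close>-th iterate on this product of falling factorials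
  is \<open>q_u\<^sup>k q_d\<^sup>l (t)\<^sub>k\<^sub>+\<^sub>l\<close> at the origin. The Stirling numbers come from expanding powers in falling factorials.
\<close>

section \<open>The one-step operator and its iterates\<close>

definition trinomial_step ::
  "(nat \<Rightarrow> nat \<Rightarrow> real) \<Rightarrow> (nat \<Rightarrow> nat \<Rightarrow> real) \<Rightarrow> (nat \<Rightarrow> nat \<Rightarrow> real) \<Rightarrow> nat \<Rightarrow> nat \<Rightarrow> real"
  where "trinomial_step a b g =
    (\<lambda>i j. a i j * g (Suc i) j + b i j * g i (Suc j) + (1 - a i j - b i j) * g i j)"

text \<open>For fixed \<open>t\<close> the iterate at one point is a polynomial in finitely many
  coefficients and values of \<open>g\<close>, so pointwise convergence of the coefficients
  suffices. One step looks at neighbouring states, hence the induction over arbitrary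
  \<open>i\<close> and \<open>j\<close>.\<close>

lemma trinomial_step_pow_tendsto:
  assumes "\<And>i j. (\<lambda>N. a N i j) \<longlonglongrightarrow> a' i j" and "\<And>i j. (\<lambda>N. b N i j) \<longlonglongrightarrow> b' i j"
  shows "(\<lambda>N. (trinomial_step (a N) (b N) ^^ t) g i j) \<longlonglongrightarrow> (trinomial_step a' b' ^^ t) g i j"
proof (induction t arbitrary: i j)
  case (Suc t)
  show ?case
    unfolding funpow.simps comp_def trinomial_step_def
    by (intro tendsto_intros assms Suc.IH[unfolded trinomial_step_def])
qed simp

text \<open>The three-term shape is that of the image of a product of falling factorials under one
  step with constant coefficients.\<close>

lemma trinomial_step_pow_linear:
  "(trinomial_step a b ^^ t) (\<lambda>i j. f i j + x * g i j + y * h i j) =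
     (\<lambda>i j. (trinomial_step a b ^^ t) f i j + x * (trinomial_step a b ^^ t) g i j
        + y * (trinomial_step a b ^^ t) h i j)"
proof (induction t)
  case (Suc t)
  have "trinomial_step a b (\<lambda>i j. f i j + x * g i j + y * h i j) =
      (\<lambda>i j. trinomial_step a b f i j + x * trinomial_step a b g i j + y * trinomial_step a b h i j)"
    for f g h
    unfolding trinomial_step_def by (intro ext) (simp add: algebra_simps)
  with Suc show ?case by simp
qed simp

lemma trinomial_step_pow_sum:
  "(trinomial_step a b ^^ t) (\<lambda>i j. \<Sum>x\<in>X. c x * g x i j) =
     (\<lambda>i j. \<Sum>x\<in>X. c x * (trinomial_step a b ^^ t) (g x) i j)"
proof (induction t)
  case (Suc t)
  have "trinomial_step a b (\<lambda>i j. \<Sum>x\<in>X. c x * h x i j) =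
      (\<lambda>i j. \<Sum>x\<in>X. c x * trinomial_step a b (h x) i j)" for h
    unfolding trinomial_step_def
    by (intro ext)
      (simp add: sum_distrib_left sum.distrib[symmetric] algebra_simps sum_subtractf[symmetric])
  with Suc show ?case by simp
qed simp

section \<open>Falling factorials and Stirling numbers\<close>

lemma falling_factorial_0 [simp]: "falling_factorial t 0 = 1"
  by (simp add: falling_factorial_def)

lemma falling_factorial_Suc_right: "falling_factorial t (Suc k) = falling_factorial t k * (real t - real k)"
  by (simp add: falling_factorial_def)

lemma falling_factorial_0_left: "falling_factorial 0 k = (if k = 0 then 1 else 0)"
  by (auto simp: falling_factorial_def)

text \<open>The discrete counterpart of differentiating a power. At \<open>k = 0\<close> the
  truncated \<open>k - 1\<close> is harmless, because its term carries the factor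
  \<open>k\<close>.\<close>

lemma falling_factorial_Suc_left:
  "falling_factorial (Suc t) k = falling_factorial t k + real k * falling_factorial t (k - 1)"
proof (induction k)
  case (Suc k)
  then show ?case
    by (cases k) (auto simp: falling_factorial_Suc_right algebra_simps)
qed simp

text \<open>Multiplying a falling factorial of order \<open>k\<close> by \<open>i\<close> gives the
  one of order \<open>k + 1\<close> plus \<open>k\<close> times itself, which matches the recurrence
  of the Stirling numbers.\<close>

lemma power_eq_sum_Stirling:
  "real i ^ n = (\<Sum>k=0..n. real (Stirling n k) * falling_factorial i k)"
proof (induction n)
  case (Suc n)
  let ?S = "\<lambda>k. real (Stirling n k)" and ?f = "falling_factorial i"
  have "(\<Sum>k\<le>Suc n. real (Stirling (Suc n) k) * ?f k)
      = (\<Sum>k\<le>n. real (Suc k) * ?S (Suc k) * ?f (Suc k)) + (\<Sum>k\<le>n. ?S k * ?f (Suc k))"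
    by (subst sum.atMost_Suc_shift) (simp add: sum.distrib[symmetric] algebra_simps)
  \<comment> \<open>Shifting the index adds only the zero term at \<open>k = 0\<close>; afterwards
    the top term is dropped because \<open>Stirling n (Suc n) = 0\<close>.\<close>
  also have "(\<Sum>k\<le>n. real (Suc k) * ?S (Suc k) * ?f (Suc k)) = (\<Sum>k\<le>Suc n. real k * ?S k * ?f k)"
    by (subst sum.atMost_Suc_shift) simp
  also have "\<dots> = (\<Sum>k\<le>n. real k * ?S k * ?f k)"
    by simp
  also have "\<dots> + (\<Sum>k\<le>n. ?S k * ?f (Suc k)) = real i * (\<Sum>k\<le>n. ?S k * ?f k)"
    by (simp add: sum.distrib[symmetric] sum_distrib_left falling_factorial_Suc_right algebra_simps)
  finally show ?case using Suc by (simp add: atLeast0AtMost)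
qed simp

section \<open>Moments for constant coefficients\<close>

lemma trinomial_step_pow_falling_factorial:
  fixes qu qd :: real
  defines "T \<equiv> trinomial_step (\<lambda>_ _. qu) (\<lambda>_ _. qd)"
  shows "(T ^^ t) (\<lambda>i j. falling_factorial i k * falling_factorial j l) 0 0 =
    qu ^ k * qd ^ l * falling_factorial t (k + l)"
proof (induction t arbitrary: k l)
  case 0
  then show ?case by (simp add: falling_factorial_0_left)
next
  case (Suc t)
  define G where "G k l = (\<lambda>i j. falling_factorial i k * falling_factorial j l)" for k l
  have T: "T (G k l) =
      (\<lambda>i j. G k l i j + qu * real k * G (k-1) l i j + qd * real l * G k (l-1) i j)"
    by (intro ext) (simp add: T_def trinomial_step_def G_def falling_factorial_Suc_left algebra_simps)
  \<comment> \<open>The innermost \<open>T\<close> is peeled off: the induction hypothesis knows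
    iterates only at the origin, but for all \<open>k\<close> and \<open>l\<close>.\<close>
  have "(T ^^ Suc t) (G k l) 0 0 = (T ^^ t) (T (G k l)) 0 0"
    by (simp add: funpow_swap1)
  also have "\<dots> = (T ^^ t) (G k l) 0 0 + qu * real k * (T ^^ t) (G (k-1) l) 0 0
       + qd * real l * (T ^^ t) (G k (l-1)) 0 0"
    by (simp only: T
        trinomial_step_pow_linear[where a = "\<lambda>_ _. qu" and b = "\<lambda>_ _. qd", folded T_def])
  also have "\<dots> = qu ^ k * qd ^ l * falling_factorial t (k + l)
      + qu * real k * (qu ^ (k-1) * qd ^ l * falling_factorial t (k - 1 + l))
      + qd * real l * (qu ^ k * qd ^ (l-1) * falling_factorial t (k + (l - 1)))"
    using Suc.IH unfolding G_def by simp
  \<comment> \<open>The last two terms merge with total weight \<open>k + l\<close>. The case split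
    handles the truncated predecessors, whose terms vanish at \<open>0\<close>.\<close>
  also have "\<dots> = qu ^ k * qd ^ l * falling_factorial (Suc t) (k + l)"
    unfolding falling_factorial_Suc_left[of t "k + l"]
    by (cases k; cases l) (simp_all add: algebra_simps)
  finally show ?case by (simp add: G_def)
qed

lemma binomial_pairs:
  fixes x y :: real
  shows "(x + y) ^ n = (\<Sum>(i, j)\<in>{(i, j). i + j = n}. fact n / (fact i * fact j) * x ^ i * y ^ j)"
proof -
  have "(\<Sum>(i, j)\<in>{(i, j). i + j = n}. fact n / (fact i * fact j) * x ^ i * y ^ j)
     = (\<Sum>k\<le>n. fact n / (fact k * fact (n - k)) * x ^ k * y ^ (n - k))"
    by (rule sum.reindex_bij_witness[of _ "\<lambda>k. (k, n - k)" fst]) auto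
  also have "\<dots> = (x + y) ^ n"
    unfolding binomial_ring by (intro sum.cong) (auto simp: binomial_fact)
  finally show ?thesis by simp
qed

text \<open>The binomial theorem splits the power into mixed monomials, the Stirling expansion turns
  these into products of falling factorials, and linearity reduces the claim to the iterates of such
  products.\<close>

lemma trinomial_step_pow_moment:
  fixes qu qd x y :: real
  shows "(trinomial_step (\<lambda>_ _. qu) (\<lambda>_ _. qd) ^^ t) (\<lambda>i j. (real i * x + real j * y) ^ n) 0 0 =
    (\<Sum>(n_u, n_d)\<in>{(i, j). i + j = n}.
       fact n / (fact n_u * fact n_d) * x ^ n_u * y ^ n_d *
       (\<Sum>k_u=0..n_u. qu ^ k_u * real (Stirling n_u k_u) *
         (\<Sum>k_d=0..n_d. qd ^ k_d * real (Stirling n_d k_d) * falling_factorial t (k_u + k_d))))"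
    (is "(?T ^^ t) _ 0 0 = _")
proof -
  let ?ff = falling_factorial
  let ?c = "\<lambda>(a, b). fact n / (fact a * fact b) * x ^ a * y ^ b :: real"
  \<comment> \<open>The nested sums, each with its coefficient in front, have exactly the shape that
    \<open>trinomial_step_pow_sum\<close> rewrites, once per sum.\<close>
  have expand: "(\<lambda>i j. (real i * x + real j * y) ^ n) =
    (\<lambda>i j. \<Sum>z\<in>{(i, j). i + j = n}. ?c z * (\<Sum>k=0..fst z. real (Stirling (fst z) k) *
       (\<Sum>l=0..snd z. real (Stirling (snd z) l) * (?ff i k * ?ff j l))))"
  proof (intro ext)
    fix i j
    have "(\<Sum>k=0..a. real (Stirling a k) * (\<Sum>l=0..b. real (Stirling b l) * (?ff i k * ?ff j l)))
       = real i ^ a * real j ^ b" for a b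
      unfolding power_eq_sum_Stirling[of i a] power_eq_sum_Stirling[of j b] sum_product
      by (simp add: sum_distrib_left ac_simps)
    then show "(real i * x + real j * y) ^ n =
      (\<Sum>z\<in>{(i, j). i + j = n}. ?c z * (\<Sum>k=0..fst z. real (Stirling (fst z) k) *
       (\<Sum>l=0..snd z. real (Stirling (snd z) l) * (?ff i k * ?ff j l))))"
      unfolding binomial_pairs
      by (intro sum.cong) (auto simp: power_mult_distrib algebra_simps)
  qed
  show ?thesis
    unfolding expand trinomial_step_pow_sum trinomial_step_pow_falling_factorial
    by (intro sum.cong refl) (auto simp: sum_distrib_left algebra_simps)
qed

section \<open>The sigma-algebra of the past\<close>

lemma sets_history_subset:
  assumes "\<And>s. X s \<in> measurable M E"
  shows "sets (history M E X t) \<subseteq> sets M"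
  unfolding history_def
  by (intro sets_image_in_sets measurable_restrict assms refl)

lemma measurable_history:
  assumes "\<And>s. X s \<in> measurable M E" and "s \<le> t"
  shows "X s \<in> measurable (history M E X t) E"
proof -
  have "(\<lambda>\<omega>. \<lambda>s\<in>{..t}. X s \<omega>) \<in> measurable (history M E X t) (PiM {..t} (\<lambda>_. E))"
    unfolding history_def
    by (intro measurable_vimage_algebra1 Pi_I measurable_space[OF measurable_restrict[OF assms(1)]])
  then have "(\<lambda>\<omega>. (\<lambda>s\<in>{..t}. X s \<omega>) s) \<in> measurable (history M E X t) E"
    by (rule measurable_compose[OF _ measurable_component_singleton]) (use assms in simp)
  with \<open>s \<le> t\<close> show ?thesis by simp
qed

section \<open>The bulls-and-bears model\<close>

context bulls_and_bears
begin

abbreviation "past \<equiv> history M (count_space UNIV \<Otimes>\<^sub>M count_space UNIV \<Otimes>\<^sub>M borel)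
  (\<lambda>s \<omega>. (Nu s \<omega>, Nd s \<omega>, p s \<omega>))"

text \<open>The three sets repeat those in the locale assumptions verbatim, so that the assumptions
  can be folded into them.\<close>

definition "bull t = {\<omega> \<in> space M. p (Suc t) \<omega> = u * p t \<omega> \<and>
  Nu t \<omega> = Nu (Suc t) \<omega> + 1 \<and> Nd (Suc t) \<omega> = Nd t \<omega>}"
definition "bear t = {\<omega> \<in> space M. p (Suc t) \<omega> = d * p t \<omega> \<and>
  Nd t \<omega> = Nd (Suc t) \<omega> + 1 \<and> Nu (Suc t) \<omega> = Nu t \<omega>}"
definition "idle t = {\<omega> \<in> space M. p (Suc t) \<omega> = p t \<omega> \<and>
  Nu (Suc t) \<omega> = Nu t \<omega> \<and> Nd (Suc t) \<omega> = Nd t \<omega>}"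

declare measurable_Nu [measurable] measurable_Nd [measurable] measurable_p [measurable]

lemma measurable_state:
  "(\<lambda>\<omega>. (Nu s \<omega>, Nd s \<omega>, p s \<omega>)) \<in>
     measurable M (count_space UNIV \<Otimes>\<^sub>M count_space UNIV \<Otimes>\<^sub>M borel)"
  by measurable

lemma subalgebra_past: "subalgebra M (past t)"
  using sets_history_subset[of "\<lambda>s \<omega>. (Nu s \<omega>, Nd s \<omega>, p s \<omega>)", OF measurable_state]
  by (auto simp: subalgebra_def history_def)

sublocale past: sigma_finite_subalgebra M "past t" for t
  by (intro finite_measure_subalgebra_is_sigma_finite finite_measure_subalgebra.intro
      finite_measure_subalgebra_axioms.intro subalgebra_past finite_measure_axioms)

lemma measurable_past_counts:
  "Nu t \<in> measurable (past t) (count_space UNIV)" "Nd t \<in> measurable (past t) (count_space UNIV)"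
  using measurable_compose[OF measurable_history[OF measurable_state order_refl] measurable_fst]
    measurable_compose[OF measurable_compose[OF
        measurable_history[OF measurable_state order_refl] measurable_snd] measurable_fst]
  by simp_all

lemma events [measurable]: "bull t \<in> events" "bear t \<in> events" "idle t \<in> events"
proof -
  have eq: "{\<omega> \<in> space M. X \<omega> = Y \<omega>} \<in> events"
    if [measurable]: "X \<in> measurable M (count_space UNIV)" "Y \<in> measurable M (count_space UNIV)"
    for X Y :: "'w \<Rightarrow> nat"
  proof -
    have "{\<omega> \<in> space M. real (X \<omega>) = real (Y \<omega>)} \<in> events" by measurable
    then show ?thesis by simp
  qed
  show "bull t \<in> events" "bear t \<in> events" "idle t \<in> events"
    unfolding bull_def bear_def idle_def by (intro sets.sets_Collect_conj eq; measurable)+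
qed

text \<open>A bounded function of the counters is measurable with respect to the past and can be
  moved into the conditional expectation. Integrability also comes from there: no bound on
  \<open>c\<close> is assumed, and the bounds on the counters are proved only later, from this
  lemma.\<close>

lemma expectation_event:
  fixes f :: "nat \<Rightarrow> nat \<Rightarrow> real"
  assumes E: "E \<in> events"
    and c: "AE \<omega> in M. real_cond_exp M (past t) (indicator E) \<omega> = c \<omega>"
    and c_meas [measurable]: "c \<in> borel_measurable M"
    and bound: "\<And>x y. \<bar>f x y\<bar> \<le> K"
  shows "integrable M (\<lambda>\<omega>. f (Nu t \<omega>) (Nd t \<omega>) * c \<omega>)"
    and "(\<integral>\<omega>. f (Nu t \<omega>) (Nd t \<omega>) * indicator E \<omega> \<partial>M) = (\<integral>\<omega>. f (Nu t \<omega>) (Nd t \<omega>) * c \<omega> \<partial>M)"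
proof -
  note [measurable] = E
  have f_past: "(\<lambda>\<omega>. f (Nu t \<omega>) (Nd t \<omega>)) \<in> borel_measurable (past t)"
    by (rule measurable_compose_countable[OF measurable_compose[OF measurable_past_counts(2)]
          measurable_past_counts(1)]) simp
  have "norm (f (Nu t \<omega>) (Nd t \<omega>) * indicator E \<omega>) \<le> K" for \<omega>
    using bound[of "Nu t \<omega>" "Nd t \<omega>"] by (auto simp: indicator_def)
  then have "integrable M (\<lambda>\<omega>. f (Nu t \<omega>) (Nd t \<omega>) * indicator E \<omega>)"
    by (intro integrable_const_bound[where B = K]) auto
  note ce = past.real_cond_exp_intg[OF this f_past borel_measurable_indicator[OF E]]
  have eq: "AE \<omega> in M. f (Nu t \<omega>) (Nd t \<omega>) * real_cond_exp M (past t) (indicator E) \<omega>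
      = f (Nu t \<omega>) (Nd t \<omega>) * c \<omega>"
    using c by eventually_elim simp
  show "integrable M (\<lambda>\<omega>. f (Nu t \<omega>) (Nd t \<omega>) * c \<omega>)"
    by (subst integrable_cong_AE[OF _ _ eq, symmetric]) (use ce in auto)
  show "(\<integral>\<omega>. f (Nu t \<omega>) (Nd t \<omega>) * indicator E \<omega> \<partial>M) = (\<integral>\<omega>. f (Nu t \<omega>) (Nd t \<omega>) * c \<omega> \<partial>M)"
    unfolding ce(2)[symmetric] by (intro integral_cong_AE eq) auto
qed

lemmas expectation_bull = expectation_event[OF events(1) bull_chosen[folded bull_def]]
lemmas expectation_bear = expectation_event[OF events(2) bear_chosen[folded bear_def]]
lemmas expectation_idle = expectation_event[OF events(3) inactive_chosen[folded idle_def]]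

text \<open>The counters alone make the three events disjoint. With \<open>f = 1\<close> each
  probability is the mean of its conditional probability, and these add up to 1.\<close>

lemma AE_event: "AE \<omega> in M. \<omega> \<in> bull t \<union> bear t \<union> idle t"
proof (rule AE_prob_1)
  have "prob (bull t \<union> bear t \<union> idle t) = prob (bull t) + prob (bear t) + prob (idle t)"
    by (subst finite_measure_Union; (subst finite_measure_Union)?)
      (use events in \<open>auto simp: bull_def bear_def idle_def\<close>)
  also have "\<dots> = (\<integral>\<omega>. Nu t \<omega> / N \<partial>M) + (\<integral>\<omega>. Nd t \<omega> / N \<partial>M)
      + (\<integral>\<omega>. (real N - Nu t \<omega> - Nd t \<omega>) / N \<partial>M)"
    using expectation_bull(2)[of t "\<lambda>_ _. 1" 1] expectation_bear(2)[of t "\<lambda>_ _. 1" 1]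
      expectation_idle(2)[of t "\<lambda>_ _. 1" 1] by simp
  also have "\<dots> = (\<integral>\<omega>. Nu t \<omega> / N + Nd t \<omega> / N + (real N - Nu t \<omega> - Nd t \<omega>) / N \<partial>M)"
    using expectation_bull(1)[of t "\<lambda>_ _. 1" 1] expectation_bear(1)[of t "\<lambda>_ _. 1" 1]
      expectation_idle(1)[of t "\<lambda>_ _. 1" 1] by (simp del: of_nat_diff)
  also have "\<dots> = 1"
    using N_pos by (simp add: add_divide_distrib[symmetric] prob_space)
  finally show "prob (bull t \<union> bear t \<union> idle t) = 1" .
qed

text \<open>The price is a function of the counters, so only these need to be followed. The bounds
  make the truncated subtractions exact.\<close>

lemma AE_price:
  "AE \<omega> in M. Nu t \<omega> \<le> nu0 \<and> Nd t \<omega> \<le> nd0 \<and>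
     p t \<omega> = p0 * u ^ (nu0 - Nu t \<omega>) * d ^ (nd0 - Nd t \<omega>)"
proof (induction t)
  case 0
  show ?case using initial by eventually_elim auto
next
  case (Suc t)
  \<comment> \<open>A counter falling from \<open>Suc k\<close> to \<open>k\<close> raises its
    exponent by one.\<close>
  have pow: "x ^ (m - k) = x * x ^ (m - Suc k)" if "Suc k \<le> m" for x :: real and m k
    using that by (metis Suc_diff_Suc Suc_le_lessD power_Suc)
  from Suc AE_event[of t] show ?case
  proof eventually_elim
    case (elim \<omega>)
    then consider "\<omega> \<in> bull t" | "\<omega> \<in> bear t" | "\<omega> \<in> idle t" by blast
    then show ?case
      by cases (use elim in \<open>simp_all add: bull_def bear_def idle_def pow\<close>)
  qed
qed

text \<open>On each of the three events the next state is a function of the present one, and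
  conditioning on the past replaces the event by its conditional probability, a coefficient of the
  operator.\<close>

lemma expectation_Suc:
  fixes g :: "nat \<Rightarrow> nat \<Rightarrow> real"
  shows "(\<integral>\<omega>. g (nu0 - Nu (Suc t) \<omega>) (nd0 - Nd (Suc t) \<omega>) \<partial>M) =
    (\<integral>\<omega>. trinomial_step (\<lambda>i _. (real nu0 - real i) / N) (\<lambda>_ j. (real nd0 - real j) / N) g
       (nu0 - Nu t \<omega>) (nd0 - Nd t \<omega>) \<partial>M)"
proof -
  let ?T = "trinomial_step (\<lambda>i _. (real nu0 - real i) / N) (\<lambda>_ j. (real nd0 - real j) / N) g"
  \<comment> \<open>\<open>g\<close> may be unbounded, but truncated subtraction keeps its arguments
    below \<open>nu0\<close> and \<open>nd0\<close> plus at most one move, a finite grid.\<close>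
  define K where "K = Max ((\<lambda>(i, j). \<bar>g i j\<bar>) ` ({..Suc nu0} \<times> {..Suc nd0}))"
  have K: "\<bar>g i j\<bar> \<le> K" if "i \<le> Suc nu0" "j \<le> Suc nd0" for i j
    unfolding K_def using that by (intro Max_ge) force+
  \<comment> \<open>The value of \<open>g\<close> after a bull, bear or idle move, in terms of the
    counters before it.\<close>
  define g1 g2 g3 where
    "g1 x y = g (Suc (nu0 - x)) (nd0 - y)" and
    "g2 x y = g (nu0 - x) (Suc (nd0 - y))" and
    "g3 x y = g (nu0 - x) (nd0 - y)" for x y
  have b: "\<bar>g1 x y\<bar> \<le> K" "\<bar>g2 x y\<bar> \<le> K" "\<bar>g3 x y\<bar> \<le> K" for x y
    unfolding g1_def g2_def g3_def by (auto intro!: K)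
  have int: "integrable M (\<lambda>\<omega>. f (Nu t \<omega>) (Nd t \<omega>) * indicator E \<omega>)"
    if "\<And>x y. \<bar>f x y\<bar> \<le> K" "E \<in> events" for f :: "nat \<Rightarrow> nat \<Rightarrow> real" and E
  proof (rule integrable_const_bound[where B = K])
    have "norm (f (Nu t \<omega>) (Nd t \<omega>) * indicator E \<omega>) \<le> K" for \<omega>
      using that(1)[of "Nu t \<omega>" "Nd t \<omega>"] by (auto simp: indicator_def)
    then show "AE \<omega> in M. norm (f (Nu t \<omega>) (Nd t \<omega>) * indicator E \<omega>) \<le> K" by simp
  qed (use that in measurable)
  have "(\<integral>\<omega>. g (nu0 - Nu (Suc t) \<omega>) (nd0 - Nd (Suc t) \<omega>) \<partial>M) =
    (\<integral>\<omega>. g1 (Nu t \<omega>) (Nd t \<omega>) * indicator (bull t) \<omega> + g2 (Nu t \<omega>) (Nd t \<omega>) * indicator (bear t) \<omega>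
       + g3 (Nu t \<omega>) (Nd t \<omega>) * indicator (idle t) \<omega> \<partial>M)"
  proof (rule integral_cong_AE)
    show "AE \<omega> in M. g (nu0 - Nu (Suc t) \<omega>) (nd0 - Nd (Suc t) \<omega>) =
       g1 (Nu t \<omega>) (Nd t \<omega>) * indicator (bull t) \<omega> + g2 (Nu t \<omega>) (Nd t \<omega>) * indicator (bear t) \<omega>
       + g3 (Nu t \<omega>) (Nd t \<omega>) * indicator (idle t) \<omega>"
      using AE_event[of t] AE_price[of t]
      by eventually_elim (auto simp: g1_def g2_def g3_def bull_def bear_def idle_def Suc_diff_Suc Suc_diff_le)
  qed measurable
  also have "\<dots> = (\<integral>\<omega>. g1 (Nu t \<omega>) (Nd t \<omega>) * indicator (bull t) \<omega> \<partial>M)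
       + (\<integral>\<omega>. g2 (Nu t \<omega>) (Nd t \<omega>) * indicator (bear t) \<omega> \<partial>M)
       + (\<integral>\<omega>. g3 (Nu t \<omega>) (Nd t \<omega>) * indicator (idle t) \<omega> \<partial>M)"
    using int[of g1, OF b(1) events(1)] int[of g2, OF b(2) events(2)] int[of g3, OF b(3) events(3)]
    by simp
  also have "\<dots> = (\<integral>\<omega>. g1 (Nu t \<omega>) (Nd t \<omega>) * (Nu t \<omega> / N) \<partial>M)
       + (\<integral>\<omega>. g2 (Nu t \<omega>) (Nd t \<omega>) * (Nd t \<omega> / N) \<partial>M)
       + (\<integral>\<omega>. g3 (Nu t \<omega>) (Nd t \<omega>) * ((real N - Nu t \<omega> - Nd t \<omega>) / N) \<partial>M)"
    by (subst expectation_bull(2)[OF _ b(1)], simp, subst expectation_bear(2)[OF _ b(2)], simp,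
        subst expectation_idle(2)[OF _ b(3)]) simp_all
  also have "\<dots> = (\<integral>\<omega>. g1 (Nu t \<omega>) (Nd t \<omega>) * (Nu t \<omega> / N) + g2 (Nu t \<omega>) (Nd t \<omega>) * (Nd t \<omega> / N)
       + g3 (Nu t \<omega>) (Nd t \<omega>) * ((real N - Nu t \<omega> - Nd t \<omega>) / N) \<partial>M)"
    using expectation_bull(1)[where f = g1 and t = t, OF _ b(1)]
      expectation_bear(1)[where f = g2 and t = t, OF _ b(2)]
      expectation_idle(1)[where f = g3 and t = t, OF _ b(3)] by simp
  also have "\<dots> = (\<integral>\<omega>. ?T (nu0 - Nu t \<omega>) (nd0 - Nd t \<omega>) \<partial>M)"
  proof (rule integral_cong_AE)
    \<comment> \<open>Since \<open>Nu t \<omega> \<le> nu0\<close> almost surely, \<open>nu0\<close>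
      minus the number of up moves is again \<open>Nu t \<omega>\<close>; likewise for
      bears.\<close>
    show "AE \<omega> in M. g1 (Nu t \<omega>) (Nd t \<omega>) * (Nu t \<omega> / N) + g2 (Nu t \<omega>) (Nd t \<omega>) * (Nd t \<omega> / N)
       + g3 (Nu t \<omega>) (Nd t \<omega>) * ((real N - Nu t \<omega> - Nd t \<omega>) / N)
       = ?T (nu0 - Nu t \<omega>) (nd0 - Nd t \<omega>)"
      using AE_price[of t]
      by eventually_elim
        (use N_pos in \<open>simp add: g1_def g2_def g3_def trinomial_step_def field_simps\<close>)
  qed measurable
  finally show ?thesis .
qed

text \<open>Each step replaces \<open>g\<close> by its image, so the induction runs over all
  \<open>g\<close>. States with more than \<open>nu0\<close> up moves do no harm although their
  coefficient is negative: the coefficient at \<open>i = nu0\<close> is zero, so they enter the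
  iterate at the origin with weight 0.\<close>

lemma expectation_counts:
  fixes g :: "nat \<Rightarrow> nat \<Rightarrow> real"
  shows "(\<integral>\<omega>. g (nu0 - Nu t \<omega>) (nd0 - Nd t \<omega>) \<partial>M) =
    (trinomial_step (\<lambda>i _. (real nu0 - real i) / N) (\<lambda>_ j. (real nd0 - real j) / N) ^^ t) g 0 0"
proof (induction t arbitrary: g)
  case 0
  have "(\<integral>\<omega>. g (nu0 - Nu 0 \<omega>) (nd0 - Nd 0 \<omega>) \<partial>M) = (\<integral>\<omega>. g 0 0 \<partial>M)"
    by (rule integral_cong_AE, measurable, use initial in eventually_elim, simp)
  then show ?case by (simp add: prob_space)
next
  case (Suc t)
  then show ?case by (simp add: expectation_Suc funpow_swap1)
qed

lemma log_return_moment: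
  assumes "0 < u" "0 < d"
  shows "(\<integral>\<omega>. ln (p t \<omega> / p 0 \<omega>) ^ n \<partial>M) =
    (trinomial_step (\<lambda>i _. (real nu0 - real i) / N) (\<lambda>_ j. (real nd0 - real j) / N) ^^ t)
      (\<lambda>i j. (real i * ln u + real j * ln d) ^ n) 0 0"
proof -
  have "(\<integral>\<omega>. ln (p t \<omega> / p 0 \<omega>) ^ n \<partial>M) =
      (\<integral>\<omega>. (real (nu0 - Nu t \<omega>) * ln u + real (nd0 - Nd t \<omega>) * ln d) ^ n \<partial>M)"
  proof (rule integral_cong_AE)
    show "AE \<omega> in M. ln (p t \<omega> / p 0 \<omega>) ^ n =
        (real (nu0 - Nu t \<omega>) * ln u + real (nd0 - Nd t \<omega>) * ln d) ^ n"
      using AE_price[of t] initial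
      by eventually_elim (use p0_pos assms in \<open>simp add: ln_mult ln_realpow del: of_nat_diff\<close>)
  qed measurable
  then show ?thesis
    by (simp only: expectation_counts[where g = "\<lambda>i j. (real i * ln u + real j * ln d) ^ n"])
qed

end

section \<open>The binomial model\<close>

context binomial_model
begin

declare measurable_S [measurable]

text \<open>For a positive price and \<open>d < u\<close> the two moves exclude each other, and
  their probabilities \<open>q\<close> and \<open>1 - q\<close> add up to 1.\<close>

lemma AE_step:
  assumes "d < u" and "AE \<omega> in M. 0 < S t \<omega>"
  shows "AE \<omega> in M. S (Suc t) \<omega> = u * S t \<omega> \<or> S (Suc t) \<omega> = d * S t \<omega>"
proof -
  let ?U = "{\<omega> \<in> space M. S (Suc t) \<omega> = u * S t \<omega>}" and ?D = "{\<omega> \<in> space M. S (Suc t) \<omega> = d * S t \<omega>}"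
  have "AE \<omega> in M. \<omega> \<notin> ?U \<or> \<omega> \<notin> ?D"
    using assms(2) by eventually_elim (use \<open>d < u\<close> in auto)
  then have "prob (?U \<union> ?D) = prob ?U + prob ?D"
    by (intro measure_Un_AE) (auto simp: fmeasurable_eq_sets)
  then have "prob (?U \<union> ?D) = 1"
    by (simp add: up_step down_step)
  then have "AE \<omega> in M. \<omega> \<in> ?U \<union> ?D" by (rule AE_prob_1)
  then show ?thesis by eventually_elim auto
qed

text \<open>A finite set of positive values yields both positivity of the price and boundedness of
  every function of it. The full square of exponents, coarser than \<open>i + j = t\<close>, is
  enough for this.\<close>

lemma AE_support:
  assumes "0 < d" "d < u"
  shows "AE \<omega> in M. S t \<omega> \<in> (\<lambda>(i, j). s0 * u ^ i * d ^ j) ` ({..t} \<times> {..t})"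
proof (induction t)
  case 0
  show ?case using initial by eventually_elim simp
next
  case (Suc t)
  let ?V = "\<lambda>t. (\<lambda>(i, j). s0 * u ^ i * d ^ j) ` ({..t} \<times> {..t})"
  have step: "u * s \<in> ?V (Suc t) \<and> d * s \<in> ?V (Suc t)" if "s \<in> ?V t" for s
  proof -
    from that obtain i j where "s = s0 * u ^ i * d ^ j" "i \<le> t" "j \<le> t" by auto
    then have "u * s = s0 * u ^ Suc i * d ^ j" "d * s = s0 * u ^ i * d ^ Suc j"
      and "(Suc i, j) \<in> {..Suc t} \<times> {..Suc t}" "(i, Suc j) \<in> {..Suc t} \<times> {..Suc t}"
      by auto
    then show ?thesis by (metis (mono_tags, lifting) image_eqI case_prod_conv)
  qed
  \<comment> \<open>Positivity at time \<open>t\<close>, required by \<open>AE_step\<close>, is read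
    off the induction hypothesis.\<close>
  have "AE \<omega> in M. 0 < S t \<omega>"
    using Suc by eventually_elim (use assms s0_pos in auto)
  from Suc AE_step[OF \<open>d < u\<close> this] show ?case
    by eventually_elim (metis step)
qed

lemma AE_S_pos:
  assumes "0 < d" "d < u"
  shows "AE \<omega> in M. 0 < S t \<omega>"
  using AE_support[OF assms, of t] by eventually_elim (use assms s0_pos in auto)

lemma integrable_S:
  fixes F :: "real \<Rightarrow> real"
  assumes "0 < d" "d < u" and [measurable]: "F \<in> borel_measurable borel"
  shows "integrable M (\<lambda>\<omega>. F (S t \<omega>))"
proof (rule integrable_const_bound)
  show "AE \<omega> in M. norm (F (S t \<omega>)) \<le>
      Max ((\<lambda>s. norm (F s)) ` (\<lambda>(i, j). s0 * u ^ i * d ^ j) ` ({..t} \<times> {..t}))"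
    using AE_support[OF assms(1,2), of t] by eventually_elim (intro Max_ge; auto)
qed measurable

text \<open>The present price belongs to the past and the growth factor is independent of the past,
  so the expectation of the product factorizes.\<close>

lemma expectation_growth:
  fixes F :: "real \<Rightarrow> real"
  assumes "0 < d" "d < u" and F [measurable]: "F \<in> borel_measurable borel"
  shows "integrable M (\<lambda>\<omega>. F (S t \<omega>) * indicator {x} (S (Suc t) \<omega> / S t \<omega>))"
    and "(\<integral>\<omega>. F (S t \<omega>) * indicator {x} (S (Suc t) \<omega> / S t \<omega>) \<partial>M) =
      (\<integral>\<omega>. F (S t \<omega>) \<partial>M) * prob {\<omega> \<in> space M. S (Suc t) \<omega> = x * S t \<omega>}"
proof -
  let ?R = "\<lambda>\<omega>. S (Suc t) \<omega> / S t \<omega>"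
  let ?H = "history M borel S t" and ?G = "vimage_algebra (space M) ?R borel"
  \<comment> \<open>A variable measurable for \<open>H\<close> generates a sigma-algebra inside
    \<open>H\<close>; thus independence of the two large sigma-algebras passes to the two
    variables.\<close>
  have sub: "sigma_sets (space M) {Y -` A \<inter> space M |A. A \<in> sets borel} \<subseteq> sets H"
    if "Y \<in> borel_measurable H" "space H = space M" for Y :: "'w \<Rightarrow> real" and H
    using measurable_sets[OF that(1)] unfolding that(2)[symmetric]
    by (intro sets.sigma_sets_subset) auto
  have "S t \<in> borel_measurable ?H"
    by (rule measurable_history[OF measurable_S order_refl])
  then have FH: "(\<lambda>\<omega>. F (S t \<omega>)) \<in> borel_measurable ?H"
    by measurable
  have "?R \<in> borel_measurable ?G"
    by (rule measurable_vimage_algebra1) simp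
  then have RG: "(\<lambda>\<omega>. indicator {x} (?R \<omega>) :: real) \<in> borel_measurable ?G"
    by measurable
  have indep: "indep_var borel (\<lambda>\<omega>. F (S t \<omega>)) borel (\<lambda>\<omega>. indicator {x} (?R \<omega>) :: real)"
    unfolding indep_var_eq
  proof (intro conjI)
    show "indep_set (sigma_sets (space M) {(\<lambda>\<omega>. F (S t \<omega>)) -` A \<inter> space M |A. A \<in> sets borel})
      (sigma_sets (space M) {(\<lambda>\<omega>. indicator {x} (?R \<omega>) :: real) -` A \<inter> space M |A. A \<in> sets borel})"
      using indep_past[of t] sub[OF FH] sub[OF RG] unfolding indep_set_def
      by (elim indep_sets_mono_sets) (auto simp: history_def split: bool.split)
  qed measurable
  have "integrable M (\<lambda>\<omega>. indicator {x} (?R \<omega>) :: real)"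
    by (rule integrable_const_bound[where B = 1]) auto
  note int = integrable_S[OF assms, of t] this
  show "integrable M (\<lambda>\<omega>. F (S t \<omega>) * indicator {x} (?R \<omega>))"
    by (rule indep_var_integrable[OF indep int])
  have "(\<integral>\<omega>. indicator {x} (?R \<omega>) \<partial>M) =
      (\<integral>\<omega>. indicator {\<omega> \<in> space M. S (Suc t) \<omega> = x * S t \<omega>} \<omega> \<partial>M :: real)"
  proof (rule integral_cong_AE)
    \<comment> \<open>Almost surely the price is nonzero, so dividing by it is legitimate and the
      quotient equals \<open>x\<close> exactly on the event.\<close>
    show "AE \<omega> in M. indicator {x} (?R \<omega>) =
        (indicator {\<omega> \<in> space M. S (Suc t) \<omega> = x * S t \<omega>} \<omega> :: real)"
      using AE_S_pos[OF assms(1,2), of t] AE_space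
      by eventually_elim (auto simp: indicator_def field_simps)
  qed measurable
  then show "(\<integral>\<omega>. F (S t \<omega>) * indicator {x} (?R \<omega>) \<partial>M) =
      (\<integral>\<omega>. F (S t \<omega>) \<partial>M) * prob {\<omega> \<in> space M. S (Suc t) \<omega> = x * S t \<omega>}"
    by (simp add: indep_var_lebesgue_integral[OF indep int])
qed

lemma expectation_Suc:
  fixes F :: "real \<Rightarrow> real"
  assumes ud: "0 < d" "d < u" and [measurable]: "F \<in> borel_measurable borel"
  shows "(\<integral>\<omega>. F (S (Suc t) \<omega>) \<partial>M) = (\<integral>\<omega>. q * F (u * S t \<omega>) + (1 - q) * F (d * S t \<omega>) \<partial>M)"
proof -
  let ?R = "\<lambda>\<omega>. S (Suc t) \<omega> / S t \<omega>"
  have Fm: "(\<lambda>s. F (u * s)) \<in> borel_measurable borel" "(\<lambda>s. F (d * s)) \<in> borel_measurable borel"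
    by measurable
  \<comment> \<open>As \<open>u\<close> and \<open>d\<close> differ, almost surely exactly one of
    the two indicators is 1.\<close>
  have "(\<integral>\<omega>. F (S (Suc t) \<omega>) \<partial>M) = (\<integral>\<omega>. F (u * S t \<omega>) * indicator {u} (?R \<omega>)
      + F (d * S t \<omega>) * indicator {d} (?R \<omega>) \<partial>M)"
  proof (rule integral_cong_AE)
    show "AE \<omega> in M. F (S (Suc t) \<omega>) = F (u * S t \<omega>) * indicator {u} (?R \<omega>)
      + F (d * S t \<omega>) * indicator {d} (?R \<omega>)"
      using AE_step[OF ud(2) AE_S_pos[OF ud], of t] AE_S_pos[OF ud, of t]
      by eventually_elim (use ud in auto)
  qed measurable
  also have "\<dots> = q * (\<integral>\<omega>. F (u * S t \<omega>) \<partial>M) + (1 - q) * (\<integral>\<omega>. F (d * S t \<omega>) \<partial>M)"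
    using expectation_growth[OF ud Fm(1)] expectation_growth[OF ud Fm(2)]
    by (simp add: up_step down_step)
  also have "\<dots> = (\<integral>\<omega>. q * F (u * S t \<omega>) + (1 - q) * F (d * S t \<omega>) \<partial>M)"
    using integrable_S[OF ud Fm(1)] integrable_S[OF ud Fm(2)] by simp
  finally show ?thesis .
qed

lemma expectation_S:
  fixes F :: "real \<Rightarrow> real"
  assumes ud: "0 < d" "d < u" and "F \<in> borel_measurable borel"
  shows "(\<integral>\<omega>. F (S t \<omega>) \<partial>M) =
    (trinomial_step (\<lambda>_ _. q) (\<lambda>_ _. 1 - q) ^^ t) (\<lambda>i j. F (s0 * u ^ i * d ^ j)) 0 0"
  using assms(3)
proof (induction t arbitrary: F)
  case 0
  note [measurable] = 0
  have "(\<integral>\<omega>. F (S 0 \<omega>) \<partial>M) = (\<integral>\<omega>. F s0 \<partial>M)"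
    by (rule integral_cong_AE, measurable, use initial in eventually_elim, simp)
  then show ?case by (simp add: prob_space)
next
  case (Suc t)
  note [measurable] = Suc.prems
  \<comment> \<open>Raising an exponent multiplies the price by \<open>u\<close> or
    \<open>d\<close>, and the weight of staying put, \<open>1 - q - (1 - q)\<close>,
    vanishes.\<close>
  have "trinomial_step (\<lambda>_ _. q) (\<lambda>_ _. 1 - q) (\<lambda>i j. F (s0 * u ^ i * d ^ j)) =
      (\<lambda>i j. q * F (u * (s0 * u ^ i * d ^ j)) + (1 - q) * F (d * (s0 * u ^ i * d ^ j)))"
    by (simp add: trinomial_step_def ac_simps)
  then show ?case
    using Suc.IH[of "\<lambda>s. q * F (u * s) + (1 - q) * F (d * s)"]
    by (simp add: expectation_Suc[OF ud Suc.prems] funpow_swap1)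
qed

lemma log_return_moment:
  assumes "0 < d" "d < u"
  shows "(\<integral>\<omega>. ln (S t \<omega> / S 0 \<omega>) ^ n \<partial>M) =
    (trinomial_step (\<lambda>_ _. q) (\<lambda>_ _. 1 - q) ^^ t) (\<lambda>i j. (real i * ln u + real j * ln d) ^ n) 0 0"
proof -
  have "(\<integral>\<omega>. ln (S t \<omega> / S 0 \<omega>) ^ n \<partial>M) = (\<integral>\<omega>. ln (S t \<omega> / s0) ^ n \<partial>M)"
    by (rule integral_cong_AE, measurable, measurable, use initial in eventually_elim, simp)
  also have "\<dots> = (trinomial_step (\<lambda>_ _. q) (\<lambda>_ _. 1 - q) ^^ t)
      (\<lambda>i j. ln (s0 * u ^ i * d ^ j / s0) ^ n) 0 0"
    by (rule expectation_S[OF assms, of "\<lambda>s. ln (s / s0) ^ n"]) measurable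
  also have "(\<lambda>i j. ln (s0 * u ^ i * d ^ j / s0) ^ n) = (\<lambda>i j. (real i * ln u + real j * ln d) ^ n)"
    using s0_pos assms by (simp add: ln_mult ln_realpow)
  finally show ?thesis .
qed

end

section \<open>The limit of many investors\<close>

lemma nat_floor_fraction_tendsto:
  fixes q :: real
  assumes "0 \<le> q"
  shows "(\<lambda>N. (real (nat \<lfloor>q * real N\<rfloor>) - real i) / real N) \<longlonglongrightarrow> q"
proof (rule tendsto_sandwich)
  show "\<forall>\<^sub>F N in sequentially. q - (1 + real i) / real N \<le> (real (nat \<lfloor>q * real N\<rfloor>) - real i) / real N"
    using eventually_gt_at_top[of 0]
  proof eventually_elim
    case (elim N)
    \<comment> \<open>The floor loses less than 1 and the moves already made cost \<open>i\<close>,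
      whence the constant \<open>1 + i\<close>.\<close>
    have "q * real N - (1 + real i) \<le> real (nat \<lfloor>q * real N\<rfloor>) - real i" by linarith
    then have "(q * real N - (1 + real i)) / real N \<le> (real (nat \<lfloor>q * real N\<rfloor>) - real i) / real N"
      by (rule divide_right_mono) simp
    with elim show ?case by (simp add: diff_divide_distrib)
  qed
  show "\<forall>\<^sub>F N in sequentially. (real (nat \<lfloor>q * real N\<rfloor>) - real i) / real N \<le> q"
    using eventually_gt_at_top[of 0]
  proof eventually_elim
    case (elim N)
    \<comment> \<open>Nonnegativity of \<open>q\<close> is what keeps \<open>nat\<close> from
      lifting the value above \<open>q * N\<close>.\<close>
    have "real (nat \<lfloor>q * real N\<rfloor>) - real i \<le> q * real N"
      using assms of_int_floor_le[of "q * real N"] by (simp del: of_int_floor_le)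
    with elim show ?case by (simp add: field_simps)
  qed
  show "(\<lambda>N. q - (1 + real i) / real N) \<longlonglongrightarrow> q"
    using tendsto_diff[OF tendsto_const lim_const_over_n, of q "1 + real i"] by simp
qed simp

theorem mainTheorem2:
  fixes u d :: real and n t :: nat
  assumes "0 < d" and "d < 1" and "1 < u" and "1 \<le> n"
  shows "(\<forall>(q_u::real) (q_d::real) (M :: nat \<Rightarrow> 'a measure) (p0 :: nat \<Rightarrow> real)
            (Nu :: nat \<Rightarrow> nat \<Rightarrow> 'a \<Rightarrow> nat) (Nd :: nat \<Rightarrow> nat \<Rightarrow> 'a \<Rightarrow> nat)
            (p :: nat \<Rightarrow> nat \<Rightarrow> 'a \<Rightarrow> real).
          0 \<le> q_u \<longrightarrow> 0 \<le> q_d \<longrightarrow> q_u + q_d \<le> 1 \<longrightarrow>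
          (\<forall>N\<ge>1. bulls_and_bears (M N) N (nat \<lfloor>q_u * real N\<rfloor>) (nat \<lfloor>q_d * real N\<rfloor>)
                     u d (p0 N) (Nu N) (Nd N) (p N)) \<longrightarrow>
          (\<lambda>N. \<integral>\<omega>. (ln (p N t \<omega> / p N 0 \<omega>)) ^ n \<partial>M N) \<longlonglongrightarrow>
          (\<Sum>(n_u, n_d) \<in> {(i, j). i + j = n}.
             fact n / (fact n_u * fact n_d) * (ln u) ^ n_u * (ln d) ^ n_d *
             (\<Sum>k_u=0..n_u. q_u ^ k_u * real (Stirling n_u k_u) *
               (\<Sum>k_d=0..n_d. q_d ^ k_d * real (Stirling n_d k_d) *
                  falling_factorial t (k_u + k_d)))))
       \<and>
         (\<forall>(q_u::real) (M :: 'b measure) (s0::real) (S :: nat \<Rightarrow> 'b \<Rightarrow> real).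
          0 \<le> q_u \<longrightarrow> q_u \<le> 1 \<longrightarrow>
          binomial_model M q_u u d s0 S \<longrightarrow>
          (\<integral>\<omega>. (ln (S t \<omega> / S 0 \<omega>)) ^ n \<partial>M) =
          (\<Sum>(n_u, n_d) \<in> {(i, j). i + j = n}.
             fact n / (fact n_u * fact n_d) * (ln u) ^ n_u * (ln d) ^ n_d *
             (\<Sum>k_u=0..n_u. q_u ^ k_u * real (Stirling n_u k_u) *
               (\<Sum>k_d=0..n_d. (1 - q_u) ^ k_d * real (Stirling n_d k_d) *
                  falling_factorial t (k_u + k_d)))))"
proof (intro conjI allI impI)
  fix q_u q_d :: real and M :: "nat \<Rightarrow> 'a measure" and p0 :: "nat \<Rightarrow> real"
    and Nu Nd :: "nat \<Rightarrow> nat \<Rightarrow> 'a \<Rightarrow> nat" and p :: "nat \<Rightarrow> nat \<Rightarrow> 'a \<Rightarrow> real"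
  assume "0 \<le> q_u" "0 \<le> q_d" and model:
    "\<forall>N\<ge>1. bulls_and_bears (M N) N (nat \<lfloor>q_u * real N\<rfloor>) (nat \<lfloor>q_d * real N\<rfloor>)
      u d (p0 N) (Nu N) (Nd N) (p N)"
  have "(\<lambda>N. (trinomial_step (\<lambda>i _. (real (nat \<lfloor>q_u * real N\<rfloor>) - real i) / real N)
        (\<lambda>_ j. (real (nat \<lfloor>q_d * real N\<rfloor>) - real j) / real N) ^^ t)
        (\<lambda>i j. (real i * ln u + real j * ln d) ^ n) 0 0)
    \<longlonglongrightarrow> (trinomial_step (\<lambda>_ _. q_u) (\<lambda>_ _. q_d) ^^ t)
        (\<lambda>i j. (real i * ln u + real j * ln d) ^ n) 0 0"
    by (intro trinomial_step_pow_tendsto nat_floor_fraction_tendsto) fact+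
  \<comment> \<open>The model is given only for \<open>N \<ge> 1\<close>, so the two sequences agree
    only eventually. The spaces \<open>M N\<close> are unrelated; only expectations are
    compared.\<close>
  moreover have "\<forall>\<^sub>F N in sequentially.
      (trinomial_step (\<lambda>i _. (real (nat \<lfloor>q_u * real N\<rfloor>) - real i) / real N)
        (\<lambda>_ j. (real (nat \<lfloor>q_d * real N\<rfloor>) - real j) / real N) ^^ t)
        (\<lambda>i j. (real i * ln u + real j * ln d) ^ n) 0 0 =
      (\<integral>\<omega>. (ln (p N t \<omega> / p N 0 \<omega>)) ^ n \<partial>M N)"
    using eventually_ge_at_top[of 1]
    by eventually_elim
      (rule bulls_and_bears.log_return_moment[symmetric], use model assms in auto)
  ultimately show "(\<lambda>N. \<integral>\<omega>. (ln (p N t \<omega> / p N 0 \<omega>)) ^ n \<partial>M N) \<longlonglongrightarrow>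
          (\<Sum>(n_u, n_d) \<in> {(i, j). i + j = n}.
             fact n / (fact n_u * fact n_d) * (ln u) ^ n_u * (ln d) ^ n_d *
             (\<Sum>k_u=0..n_u. q_u ^ k_u * real (Stirling n_u k_u) *
               (\<Sum>k_d=0..n_d. q_d ^ k_d * real (Stirling n_d k_d) *
                  falling_factorial t (k_u + k_d))))"
    unfolding trinomial_step_pow_moment by (rule Lim_transform_eventually)
next
  fix q_u s0 :: real and M :: "'b measure" and S :: "nat \<Rightarrow> 'b \<Rightarrow> real"
  assume "binomial_model M q_u u d s0 S"
  then show "(\<integral>\<omega>. (ln (S t \<omega> / S 0 \<omega>)) ^ n \<partial>M) =
          (\<Sum>(n_u, n_d) \<in> {(i, j). i + j = n}.
             fact n / (fact n_u * fact n_d) * (ln u) ^ n_u * (ln d) ^ n_d *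
             (\<Sum>k_u=0..n_u. q_u ^ k_u * real (Stirling n_u k_u) *
               (\<Sum>k_d=0..n_d. (1 - q_u) ^ k_d * real (Stirling n_d k_d) *
                  falling_factorial t (k_u + k_d))))"
    unfolding trinomial_step_pow_moment[symmetric]
    using assms by (intro binomial_model.log_return_moment) auto
qed

end
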